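(* Let $U$ be an $n\times m$ standardized matrix. For $\varepsilon\in(0,1)$, there exists a partition of $\{1,\dots,m\}$ into $p$ sets $\sigma_1,\dots,\sigma_p$ such that $$p\leq\frac{9\|U\|^2\log(m)}{\varepsilon^2}$$ and for any $i\leq p$, $$1-\varepsilon\leq s_{\min}\left(U_{\sigma_i}\right)\leq s_{\max}\left(U_{\sigma_i}\right)\leq1+\varepsilon.$$
   Context: Matrices are real. A matrix is standardized if all its columns have Euclidean norm $1$. $\|U\|$ is the operator norm of $U$ seen as an operator from $\ell_2^m$ to $\ell_2^n$. For $\sigma\subset\{1,\dots,m\}$, $U_\sigma$ is the restriction of $U$ to the columns with indices in $\sigma$, viewed as an operator $\mathbb{R}^\sigma\to\mathbb{R}^n$; $s_{\min}(U_\sigma)$ and $s_{\max}(U_\sigma)$ are its smallest and largest singular values, that is, the minimum and maximum of $\|U_\sigma x\|_2$ over unit vectors $x\in\mathbb{R}^\sigma$. $\log$ is the natural logarithm.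
   Formalization: The formal theorem assumes m ≥ 2: for m = 1 the stated bound gives p ≤ 0 since log(1) = 0, while a partition of {1} needs at least one set, so the claim fails there; for m = 0 the logarithm is undefined. *)

theory Defs
  imports "HOL-Analysis.Analysis" "HOL-Library.Disjoint_Sets"
begin

definition standardized :: "real^'m^'n \<Rightarrow> bool" where
  "standardized U \<longleftrightarrow> (\<forall>j. norm (column j U) = 1)"

(* The space of real vectors indexed by \<sigma> is represented by the coordinate subspace of
   vectors supported on \<sigma>, which carries the same Euclidean norm. *)
definition coord_space :: "'m::finite set \<Rightarrow> (real^'m) set" where
  "coord_space \<sigma> = {x. \<forall>j. j \<notin> \<sigma> \<longrightarrow> x $ j = 0}"

(* Columns outside \<sigma> are replaced by 0; the resulting matrix is only ever applied to vectors
   of coord_space \<sigma>, where it acts as the submatrix of the columns indexed by \<sigma>. In particular,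
   the zero columns do not contribute to the singular values below. *)
definition col_restrict :: "real^'m^'n \<Rightarrow> 'm set \<Rightarrow> real^'m^'n" where
  "col_restrict U \<sigma> = (\<chi> i j. if j \<in> \<sigma> then U $ i $ j else 0)"

definition unit_values :: "real^'m^'n \<Rightarrow> 'm set \<Rightarrow> real set" where
  "unit_values U \<sigma> = {norm (col_restrict U \<sigma> *v x) | x. x \<in> coord_space \<sigma> \<and> norm x = 1}"

(* For nonempty \<sigma> the infimum and supremum are attained; see s_min_attained, s_max_attained. *)
definition s_min :: "real^'m^'n \<Rightarrow> 'm set \<Rightarrow> real" where
  "s_min U \<sigma> = Inf (unit_values U \<sigma>)"

definition s_max :: "real^'m^'n \<Rightarrow> 'm set \<Rightarrow> real" where
  "s_max U \<sigma> = Sup (unit_values U \<sigma>)"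

lemma compact_unit_values:
  fixes U :: "real^'m::finite^'n::finite"
  shows "compact (unit_values U \<sigma>)"
proof -
  have eq: "unit_values U \<sigma> =
      (\<lambda>x. norm (col_restrict U \<sigma> *v x)) ` (sphere 0 1 \<inter> coord_space \<sigma>)"
    unfolding unit_values_def by (auto simp: image_iff)
  have "coord_space \<sigma> = (\<Inter>j\<in>- \<sigma>. {x. x $ j = 0})"
    unfolding coord_space_def by auto
  moreover have "closed {x. (x::real^'m) $ j = 0}" for j
    by (intro closed_Collect_eq continuous_intros)
  ultimately have "closed (coord_space \<sigma>)" by auto
  then have "compact (sphere 0 1 \<inter> coord_space \<sigma>)"
    by (intro compact_Int_closed compact_sphere)
  then show ?thesis
    unfolding eq
    by (intro compact_continuous_image continuous_on_norm
          linear_continuous_on matrix_vector_mul_bounded_linear)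
qed

lemma unit_values_nonempty:
  assumes "\<sigma> \<noteq> {}"
  shows "unit_values U \<sigma> \<noteq> {}"
proof -
  obtain j where "j \<in> \<sigma>" using assms by blast
  then have "axis j (1::real) \<in> coord_space \<sigma>"
    by (auto simp: coord_space_def axis_def)
  moreover have "norm (axis j (1::real)) = 1"
    by simp
  ultimately show ?thesis unfolding unit_values_def by blast
qed

lemma s_min_attained: "\<sigma> \<noteq> {} \<Longrightarrow> s_min U \<sigma> \<in> unit_values U \<sigma>"
  unfolding s_min_def
  by (intro closed_contains_Inf unit_values_nonempty bounded_imp_bdd_below
        compact_imp_bounded compact_imp_closed compact_unit_values)

lemma s_max_attained: "\<sigma> \<noteq> {} \<Longrightarrow> s_max U \<sigma> \<in> unit_values U \<sigma>"
  unfolding s_max_def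
  by (intro closed_contains_Sup unit_values_nonempty bounded_imp_bdd_above
        compact_imp_bounded compact_imp_closed compact_unit_values)

end

theory Submission imports Defs begin

text \<open>
  The partition is built greedily. Every nonempty set \<open>\<tau>\<close> of columns contains a subset \<open>\<sigma>\<close> with at least
  the fraction \<open>c = \<epsilon>\<^sup>2 / (9 \<parallel>U\<parallel>\<^sup>2)\<close> of its elements, on which \<open>U\<close> is an isometry up to the factors \<open>1 - \<epsilon>\<close>
  and \<open>1 + \<epsilon>\<close> (\<open>exists_large_near_isometry\<close>). Removing such subsets one after the other multiplies the number
  of remaining columns by at most \<open>1 - c\<close> each time, so \<open>ln m / c\<close> of them exhaust all columns
  (\<open>greedy_partition\<close>).

  The subset is found by the barrier method of Batson, Spielman and Srivastava, carried out on
  the Gram matrix \<open>G = U\<^sup>T U\<close>. While columns are added one at a time, the spectrum of the principal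
  submatrix \<open>G\<^sub>\<sigma>\<close> is kept strictly between a lower barrier \<open>l\<close> and an upper barrier \<open>w\<close>, and a weighted sum of
  the traces of \<open>(w - G\<^sub>\<sigma>)\<inverse>\<close> and \<open>(G\<^sub>\<sigma> - l)\<inverse>\<close> is kept small. The growth of either trace under a new
  column is given by a Schur complement (\<open>block_inverse_insert\<close>). It involves the energies of the
  vector of inner products with the new column, and since \<open>G\<^sup>2 \<le> \<parallel>U\<parallel>\<^sup>2 G\<close> these energies are small on
  average over \<open>\<tau>\<close> (\<open>sum_column_energy_le\<close>). The part of the growth that is proportional to
  the trace of the squared inverse is cancelled by moving the barriers outwards a little before each
  step (\<open>block_inverse_shift\<close>). Hence some column raises the weighted sum by no more than a constant
  (\<open>exists_column_within_barriers\<close>), and the constants of \<open>barrier_constants\<close> allow \<open>\<epsilon>\<^sup>2 |\<tau>| / (9 \<parallel>U\<parallel>\<^sup>2)\<close> steps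
  before the barriers pass \<open>(1 - \<epsilon>)\<^sup>2\<close> or \<open>(1 + \<epsilon>)\<^sup>2\<close>.
\<close>

section \<open>Matrix algebra\<close>

lemma matrix_add_rdistrib: "((A::real^'b^'a) + B) ** C = A ** C + B ** C"
  by (simp add: vec_eq_iff matrix_matrix_mult_def sum.distrib[symmetric] algebra_simps)

lemma matrix_diff_ldistrib: "(A::real^'b^'a) ** (B - C) = A ** B - A ** C"
  by (simp add: vec_eq_iff matrix_matrix_mult_def sum_subtractf[symmetric] algebra_simps)

lemma matrix_diff_rdistrib: "((A::real^'b^'a) - B) ** C = A ** C - B ** C"
  by (simp add: vec_eq_iff matrix_matrix_mult_def sum_subtractf[symmetric] algebra_simps)

lemma matrix_scaleR_left: "(k *\<^sub>R A) ** B = k *\<^sub>R (A ** (B::real^'c^'b))"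
  by (simp add: scalar_matrix_assoc)

lemma matrix_scaleR_right: "A ** (k *\<^sub>R B) = k *\<^sub>R (A ** (B::real^'c^'b))"
  by (simp add: matrix_scalar_ac scalar_matrix_assoc)

lemmas matrix_distribs = matrix_add_ldistrib matrix_add_rdistrib matrix_diff_ldistrib
  matrix_diff_rdistrib matrix_scaleR_left matrix_scaleR_right

lemma trace_scaleR: "trace (c *\<^sub>R (A::real^'a^'a)) = c * trace A"
  by (simp add: trace_def sum_distrib_left)

lemma transpose_plus: "transpose (A + B) = transpose A + transpose (B::real^'b^'a)"
  by (simp add: vec_eq_iff transpose_def)

lemma transpose_0: "transpose (0::real^'b^'a) = 0"
  by (simp add: vec_eq_iff transpose_def)

lemma inner_symmetric_matrix:
  fixes A :: "real^'a^'a"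
  assumes "transpose A = A"
  shows "(A *v x) \<bullet> y = x \<bullet> (A *v y)"
  by (metis assms dot_lmul_matrix transpose_matrix_vector)

definition outer :: "real^'a \<Rightarrow> real^'a \<Rightarrow> real^'a^'a" where
  "outer x y = (\<chi> i j. x $ i * y $ j)"

lemma matrix_mul_outer: "A ** outer x y = outer (A *v x) y"
  by (simp add: outer_def vec_eq_iff matrix_matrix_mult_def matrix_vector_mult_def
      sum_distrib_right mult.assoc)

lemma outer_mul_vector: "outer x y *v z = (y \<bullet> z) *\<^sub>R x"
  by (simp add: outer_def vec_eq_iff matrix_vector_mult_def inner_vec_def
      sum_distrib_right sum_distrib_left mult_ac)

lemma trace_outer: "trace (outer x y) = x \<bullet> y"
  by (simp add: outer_def trace_def inner_vec_def)

lemma transpose_outer: "transpose (outer x y) = outer y x"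
  by (simp add: outer_def transpose_def vec_eq_iff mult.commute)

lemma outer_diff_right: "outer x (y - z) = outer x y - outer x z"
  by (simp add: outer_def vec_eq_iff algebra_simps)

lemma outer_scaleR_left: "outer (c *\<^sub>R x) y = c *\<^sub>R outer x y"
  by (simp add: outer_def vec_eq_iff algebra_simps)

lemma outer_mul_matrix: "outer x y ** A = outer x (transpose A *v y)"
  by (metis matrix_mul_outer matrix_transpose_mul transpose_outer transpose_transpose)

lemma inner_matrix_axis: "axis j 1 \<bullet> ((A::real^'a^'b) *v axis j' 1) = A $ j $ j'"
  by (simp add: inner_axis' matrix_vector_mult_basis column_def)

lemma trace_eq_sum_axis: "trace A = (\<Sum>j\<in>UNIV. axis j 1 \<bullet> ((A::real^'a^'a) *v axis j 1))"
  by (simp add: trace_def inner_matrix_axis)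

section \<open>Positivity tested by traces\<close>

text \<open>
  The dual cone of the positive semidefinite forms, under the trace pairing. That cone is self-dual,
  so for symmetric matrices this is positive semidefiniteness itself. The dual description is chosen
  because it can be carried along rank-one updates, and yields trace inequalities, without any
  square root, factorization or eigenbasis of the matrix.
\<close>
definition trace_psd :: "real^'a^'a \<Rightarrow> bool" where
  "trace_psd R \<longleftrightarrow> (\<forall>C. (\<forall>z. 0 \<le> z \<bullet> (C *v z)) \<longrightarrow> 0 \<le> trace (C ** R))"

lemma trace_psd_0: "trace_psd 0"
  by (simp add: trace_psd_def matrix_matrix_mult_def trace_def)

lemma trace_psd_add_outer:
  assumes "trace_psd R" "0 \<le> c"
  shows "trace_psd (R + c *\<^sub>R outer z z)"
  using assms unfolding trace_psd_def
  by (auto simp: matrix_distribs matrix_mul_outer trace_add trace_scaleR trace_outer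
      inner_commute scaleR_matrix_vector_assoc[symmetric])

lemma trace_psd_inner:
  assumes "trace_psd R"
  shows "0 \<le> y \<bullet> (R *v y)"
proof -
  have "0 \<le> trace (outer y y ** R)"
    using assms unfolding trace_psd_def by (simp add: outer_mul_vector inner_commute)
  also have "trace (outer y y ** R) = y \<bullet> (R *v y)"
    by (simp add: trace_mul_sym[of _ R] matrix_mul_outer trace_outer inner_commute)
  finally show ?thesis .
qed

lemma trace_psd_square:
  assumes "transpose R = R"
  shows "trace_psd (R ** R)"
  unfolding trace_psd_def
proof (intro allI impI)
  fix C :: "real^'a^'a"
  assume C: "\<forall>z. 0 \<le> z \<bullet> (C *v z)"
  have "trace (C ** (R ** R)) = trace (R ** (C ** R))"
    by (metis matrix_mul_assoc trace_mul_sym)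
  also have "\<dots> = (\<Sum>j\<in>UNIV. (R *v axis j 1) \<bullet> (C *v (R *v axis j 1)))"
    by (simp add: trace_eq_sum_axis matrix_vector_mul_assoc[symmetric]
        inner_symmetric_matrix[OF assms])
  also have "0 \<le> \<dots>" using C by (intro sum_nonneg) auto
  finally show "0 \<le> trace (C ** (R ** R))" .
qed

section \<open>Inverses of principal submatrices\<close>

definition coord_proj :: "'a::finite set \<Rightarrow> real^'a^'a" where
  "coord_proj \<sigma> = (\<chi> i j. if i = j \<and> i \<in> \<sigma> then 1 else 0)"

lemma coord_proj_vec: "(coord_proj \<sigma> *v x) $ i = (if i \<in> \<sigma> then x $ i else 0)"
proof -
  have "(coord_proj \<sigma> *v x) $ i = (\<Sum>j\<in>UNIV. if i = j then (if i \<in> \<sigma> then x $ j else 0) else 0)"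
    by (simp add: coord_proj_def matrix_vector_mult_def if_distrib[of "\<lambda>u. u * _"] if_conn
        cong: if_cong)
  also have "\<dots> = (if i \<in> \<sigma> then x $ i else 0)" by simp
  finally show ?thesis .
qed

lemma coord_proj_axis_in: "j \<in> \<sigma> \<Longrightarrow> coord_proj \<sigma> *v axis j 1 = axis j 1"
  by (auto simp: vec_eq_iff coord_proj_vec axis_def)

lemma coord_proj_axis_out: "j \<notin> \<sigma> \<Longrightarrow> coord_proj \<sigma> *v axis j 1 = 0"
  by (auto simp: vec_eq_iff coord_proj_vec axis_def)

lemma coord_proj_coord_space: "x \<in> coord_space \<sigma> \<longleftrightarrow> coord_proj \<sigma> *v x = x"
  by (auto simp: vec_eq_iff coord_proj_vec coord_space_def)

lemma transpose_coord_proj: "transpose (coord_proj \<sigma>) = coord_proj \<sigma>"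
  by (auto simp: coord_proj_def transpose_def vec_eq_iff)

lemma coord_proj_empty: "coord_proj {} = 0"
  by (simp add: coord_proj_def vec_eq_iff)

lemma trace_coord_proj: "trace (coord_proj \<sigma>) = real (card \<sigma>)"
  by (simp add: coord_proj_def trace_def sum.If_cases)

lemma coord_proj_insert:
  "j \<notin> \<sigma> \<Longrightarrow> coord_proj (insert j \<sigma>) = coord_proj \<sigma> + outer (axis j 1) (axis j 1)"
  by (auto simp: coord_proj_def outer_def vec_eq_iff axis_def)

text \<open>
  \<open>R\<close> is the inverse of the principal submatrix of \<open>K\<close> with indices in \<open>\<sigma>\<close>, extended by zero to a
  matrix of full size, so that \<open>\<sigma>\<close> can grow without a change of type. The condition
  \<open>trace_psd R\<close> records in addition that this submatrix is positive definite.
\<close>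
definition block_inverse :: "real^'a^'a \<Rightarrow> 'a set \<Rightarrow> real^'a^'a \<Rightarrow> bool" where
  "block_inverse K \<sigma> R \<longleftrightarrow> transpose R = R \<and> coord_proj \<sigma> ** R = R \<and>
     coord_proj \<sigma> ** K ** R = coord_proj \<sigma> \<and> trace_psd R"

lemma block_inverse_empty: "block_inverse K {} 0"
  by (simp add: block_inverse_def coord_proj_empty trace_psd_0 transpose_0)

lemma block_inverse_right:
  assumes "block_inverse K \<sigma> R" "transpose K = K"
  shows "R ** coord_proj \<sigma> = R" "R ** K ** coord_proj \<sigma> = coord_proj \<sigma>"
proof -
  have R: "transpose R = R" "coord_proj \<sigma> ** R = R" "coord_proj \<sigma> ** K ** R = coord_proj \<sigma>"
    using assms(1) by (auto simp: block_inverse_def)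
  show "R ** coord_proj \<sigma> = R"
    by (metis R(1,2) matrix_transpose_mul transpose_coord_proj)
  show "R ** K ** coord_proj \<sigma> = coord_proj \<sigma>"
    by (metis R(1,3) assms(2) matrix_mul_assoc matrix_transpose_mul transpose_coord_proj)
qed

lemma block_inverse_mult:
  assumes "block_inverse K \<sigma> R" "block_inverse K' \<sigma> R'" "transpose K = K"
  shows "R ** K ** R' = R'"
  using block_inverse_right[OF assms(1,3)] assms(2)
  by (metis block_inverse_def matrix_mul_assoc)

text \<open>
  On the coordinate subspace, \<open>x = R (K x)\<close>, so the form of \<open>K\<close> at \<open>x\<close> is the form of \<open>R\<close> at \<open>K x\<close>.
\<close>
lemma block_inverse_nonneg:
  assumes "block_inverse K \<sigma> R" "transpose K = K" "x \<in> coord_space \<sigma>"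
  shows "0 \<le> x \<bullet> (K *v x)"
proof -
  have "R *v (K *v x) = x"
    using block_inverse_right(2)[OF assms(1,2)] assms(3)
    by (metis coord_proj_coord_space matrix_vector_mul_assoc)
  moreover have "0 \<le> (K *v x) \<bullet> (R *v (K *v x))"
    using assms(1) by (intro trace_psd_inner) (simp add: block_inverse_def)
  ultimately show ?thesis by (simp add: inner_commute)
qed

text \<open>
  Schur complements. The vector \<open>z\<close> is the one with \<open>z $ j = 1\<close> whose image under \<open>K\<close> vanishes on \<open>\<sigma>\<close>;
  hence \<open>K z\<close> is \<open>d\<close> times a unit vector on the enlarged block, and a rank-one multiple of \<open>z z\<^sup>T\<close>
  completes the old inverse to the new one. Positivity of the single number \<open>d\<close> decides whether the
  enlarged block is still positive definite.
\<close>
lemma block_inverse_insert: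
  fixes K R :: "real^'a^'a"
  assumes "block_inverse K \<sigma> R" "transpose K = K" "j \<notin> \<sigma>"
  defines "h \<equiv> K *v axis j 1"
  defines "z \<equiv> axis j 1 - R *v h"
  defines "d \<equiv> K $ j $ j - h \<bullet> (R *v h)"
  shows "z \<bullet> (K *v z) = d"
    and "z \<in> coord_space (insert j \<sigma>)" and "z $ j = 1"
    and "0 < d \<Longrightarrow> block_inverse K (insert j \<sigma>) (R + (1 / d) *\<^sub>R outer z z)"
    and "trace (R + (1 / d) *\<^sub>R outer z z) = trace R + (1 + (norm (R *v h))\<^sup>2) / d"
proof -
  let ?P = "coord_proj \<sigma>" and ?e = "axis j 1 :: real^'a"
  have R: "transpose R = R" "?P ** R = R" "?P ** K ** R = ?P" "trace_psd R"
    using assms(1) by (auto simp: block_inverse_def)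
  note RP = block_inverse_right[OF assms(1,2)]
  have PRh: "?P *v (R *v h) = R *v h" by (metis R(2) matrix_vector_mul_assoc)
  have Re: "R *v ?e = 0"
    by (metis RP(1) assms(3) coord_proj_axis_out matrix_vector_mul_assoc matrix_vector_mult_0_right)
  have orth: "?e \<bullet> (R *v h) = 0"
    by (metis Re R(1) inner_symmetric_matrix inner_zero_left)
  have PKz: "?P *v (K *v z) = 0"
  proof -
    have "?P *v (K *v (R *v h)) = ?P *v h"
      by (metis R(3) matrix_vector_mul_assoc)
    then show ?thesis unfolding z_def h_def by (simp add: matrix_vector_mult_diff_distrib)
  qed
  have eKz: "?e \<bullet> (K *v z) = d"
    unfolding z_def d_def h_def
    by (simp add: matrix_vector_mult_diff_distrib inner_diff_right inner_matrix_axis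
        inner_symmetric_matrix[OF assms(2), of ?e, symmetric])
  have RhKz: "(R *v h) \<bullet> (K *v z) = 0"
    by (metis PRh PKz inner_symmetric_matrix transpose_coord_proj inner_zero_right)
  show zKz: "z \<bullet> (K *v z) = d"
    unfolding z_def using eKz RhKz by (simp add: inner_diff_left z_def)
  have Ph: "coord_proj (insert j \<sigma>) *v (R *v h) = R *v h"
  proof -
    have "R *v h \<in> coord_space \<sigma>" using PRh by (simp add: coord_proj_coord_space)
    then have "R *v h \<in> coord_space (insert j \<sigma>)" by (simp add: coord_space_def)
    then show ?thesis by (simp add: coord_proj_coord_space)
  qed
  show "z \<in> coord_space (insert j \<sigma>)"
    unfolding coord_proj_coord_space z_def
    by (simp add: matrix_vector_mult_diff_distrib coord_proj_axis_in Ph)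
  then have Pz: "coord_proj (insert j \<sigma>) *v z = z" by (simp add: coord_proj_coord_space)
  show "z $ j = 1"
    using orth unfolding z_def by (simp add: inner_axis')
  have nz: "z \<bullet> z = 1 + (norm (R *v h))\<^sup>2"
    unfolding z_def using orth
    by (simp add: inner_diff_left inner_diff_right inner_commute inner_axis_axis
        power2_norm_eq_inner)
  show "trace (R + (1 / d) *\<^sub>R outer z z) = trace R + (1 + (norm (R *v h))\<^sup>2) / d"
    by (simp add: trace_add trace_scaleR trace_outer nz)
  show "block_inverse K (insert j \<sigma>) (R + (1 / d) *\<^sub>R outer z z)" if d: "0 < d"
    unfolding block_inverse_def
  proof (intro conjI)
    let ?R = "R + (1 / d) *\<^sub>R outer z z" and ?P' = "coord_proj (insert j \<sigma>)"
    show "transpose ?R = ?R"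
      by (simp add: transpose_plus transpose_scalar transpose_outer R(1))
    have "?P' ** R = R"
      by (simp add: coord_proj_insert[OF assms(3)] matrix_distribs R(2) outer_mul_matrix R(1) Re
          del: transpose_matrix_vector) (simp add: outer_def vec_eq_iff)
    then show "?P' ** ?R = ?R"
      by (simp add: matrix_distribs matrix_mul_outer Pz)
    have P'Kz: "?P' *v (K *v z) = d *\<^sub>R ?e"
      by (simp add: coord_proj_insert[OF assms(3)] matrix_vector_mult_add_rdistrib PKz
          outer_mul_vector eKz)
    have "?P' ** K ** R = ?P + outer ?e (R *v h)"
      unfolding coord_proj_insert[OF assms(3)] h_def
      by (simp add: matrix_distribs R(3) outer_mul_matrix R(1) assms(2)
          del: transpose_matrix_vector)
    moreover have "?P' ** K ** outer z z = d *\<^sub>R outer ?e z"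
      by (simp add: matrix_mul_outer matrix_vector_mul_assoc[symmetric] P'Kz outer_scaleR_left)
    ultimately have "?P' ** K ** ?R = ?P + outer ?e (R *v h) + outer ?e z"
      using d by (simp add: matrix_add_ldistrib matrix_scaleR_right)
    also have "\<dots> = ?P'"
      by (simp add: coord_proj_insert[OF assms(3)] z_def outer_diff_right)
    finally show "?P' ** K ** ?R = ?P'" .
    show "trace_psd ?R" using d R(4) by (intro trace_psd_add_outer) auto
  qed
qed

text \<open>
  By induction on the block: at each insertion the Schur complement is the value of the form at the
  vector \<open>z\<close> of the preceding lemma, hence positive.
\<close>
lemma block_inverse_exists:
  fixes K :: "real^'a^'a"
  assumes "transpose K = K"
    and "\<And>x. x \<in> coord_space \<sigma> \<Longrightarrow> x \<noteq> 0 \<Longrightarrow> 0 < x \<bullet> (K *v x)"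
  shows "\<exists>R. block_inverse K \<sigma> R"
  using finite[of \<sigma>] assms(2)
proof (induction \<sigma> rule: finite_induct)
  case empty
  then show ?case using block_inverse_empty by blast
next
  case (insert j \<sigma>)
  have "coord_space \<sigma> \<subseteq> coord_space (insert j \<sigma>)" by (auto simp: coord_space_def)
  with insert obtain R where R: "block_inverse K \<sigma> R" by blast
  note ext = block_inverse_insert[OF R assms(1) insert.hyps(2)]
  show ?case
    using ext(4) insert.prems[OF ext(2)] ext(1,3) by (metis zero_index zero_neq_one)
qed

text \<open>
  Raising the diagonal by \<open>\<eta>\<close> lowers the trace of the inverse by at least \<open>\<eta>\<close> times the trace of the
  squared new inverse. The resolvent identity in its two orders, \<open>R = R' + \<eta> R' R = R' + \<eta> R R'\<close>, gives
  \<open>R = R' + \<eta> R' R' + \<eta>\<^sup>2 R' R R'\<close>, and the last term has nonnegative trace. This gain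
  pays for the squared inverses that appear when a column is added.
\<close>
lemma block_inverse_shift:
  fixes K :: "real^'a^'a"
  assumes R: "block_inverse K \<sigma> R" and K: "transpose K = K" and \<eta>: "0 < \<eta>"
  shows "\<exists>R'. block_inverse (K + \<eta> *\<^sub>R mat 1) \<sigma> R' \<and>
    trace R' + \<eta> * trace (R' ** R') \<le> trace R"
proof -
  let ?K = "K + \<eta> *\<^sub>R mat 1"
  have K': "transpose ?K = ?K" by (simp add: transpose_plus transpose_scalar K)
  have "0 < x \<bullet> (?K *v x)" if "x \<in> coord_space \<sigma>" "x \<noteq> 0" for x
  proof -
    have "x \<bullet> (?K *v x) = x \<bullet> (K *v x) + \<eta> * (x \<bullet> x)"
      by (simp add: matrix_vector_mult_add_rdistrib scaleR_matrix_vector_assoc[symmetric] inner_add_right)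
    moreover have "0 < \<eta> * (x \<bullet> x)" using that \<eta> by simp
    ultimately show ?thesis using block_inverse_nonneg[OF R K that(1)] by linarith
  qed
  then obtain R' where R': "block_inverse ?K \<sigma> R'"
    using block_inverse_exists[OF K'] by blast
  have sym: "transpose R = R" "transpose R' = R'" using R R' by (auto simp: block_inverse_def)
  have 4: "R ** K ** R' = R'" by (rule block_inverse_mult[OF R R' K])
  then have "transpose (R ** K ** R') = R'" by (simp add: sym)
  then have 1: "R' ** K ** R = R'" by (simp add: matrix_transpose_mul sym K matrix_mul_assoc)
  have 2: "R' ** ?K ** R = R" by (rule block_inverse_mult[OF R' R K'])
  then have "transpose (R' ** ?K ** R) = R" by (simp add: sym)
  then have 3: "R ** ?K ** R' = R" by (simp add: matrix_transpose_mul sym K' matrix_mul_assoc)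
  have A: "R = R' + \<eta> *\<^sub>R (R' ** R)" using 1 2 by (simp add: matrix_distribs)
  have B: "R = R' + \<eta> *\<^sub>R (R ** R')" using 3 4 by (simp add: matrix_distribs)
  have "trace (R' ** R) = trace (R' ** R') + \<eta> * trace (R' ** (R ** R'))"
    by (subst B) (simp add: matrix_distribs trace_add trace_scaleR)
  also have "trace (R' ** (R ** R')) = trace (R' ** R' ** R)"
    by (metis matrix_mul_assoc trace_mul_sym)
  finally have eq: "trace (R' ** R) = trace (R' ** R') + \<eta> * trace (R' ** R' ** R)" .
  have "0 \<le> trace (R' ** R' ** R)"
  proof -
    have "0 \<le> z \<bullet> ((R' ** R') *v z)" for z
      by (simp add: matrix_vector_mul_assoc[symmetric] inner_symmetric_matrix[OF sym(2), of z "R' *v z", symmetric])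
    then show ?thesis using R by (simp add: block_inverse_def trace_psd_def)
  qed
  then have "trace (R' ** R') \<le> trace (R' ** R)" using eq \<eta> by simp
  moreover have "trace R = trace R' + \<eta> * trace (R' ** R)"
    by (subst A) (simp add: trace_add trace_scaleR)
  ultimately have "trace R' + \<eta> * trace (R' ** R') \<le> trace R"
    using \<eta> by (simp add: mult_left_mono)
  then show ?thesis using R' by blast
qed

section \<open>Gram matrices and column energies\<close>

definition gram :: "real^'m^'n \<Rightarrow> real^'m^'m" where
  "gram U = transpose U ** U"

lemma transpose_gram: "transpose (gram U) = gram U"
  by (simp add: gram_def matrix_transpose_mul)

lemma inner_gram: "x \<bullet> (gram U *v x) = (norm (U *v x))\<^sup>2"
  by (metis dot_lmul_matrix gram_def matrix_vector_mul_assoc power2_norm_eq_inner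
      transpose_matrix_vector transpose_transpose)

lemma gram_diag: "standardized U \<Longrightarrow> gram U $ j $ j = 1"
  using inner_gram[of "axis j 1" U]
  by (simp add: standardized_def matrix_vector_mult_basis inner_axis' column_def)

lemma norm_matrix_vector_le: "norm (U *v x) \<le> onorm ((*v) (U::real^'m^'n)) * norm x"
  by (rule onorm) (rule matrix_vector_mul_bounded_linear)

text \<open>
  This says \<open>G\<^sup>2 \<le> \<parallel>U\<parallel>\<^sup>2 G\<close> as forms, which is how the operator norm enters the averages.
\<close>
lemma norm_gram_vector_le:
  fixes U :: "real^'m^'n"
  shows "(norm (gram U *v v))\<^sup>2 \<le> (onorm ((*v) U))\<^sup>2 * (v \<bullet> (gram U *v v))"
proof -
  let ?y = "U *v v" and ?g = "gram U *v v"
  have g: "?g = transpose U *v ?y" by (simp add: gram_def matrix_vector_mul_assoc del: transpose_matrix_vector)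
  have "(norm ?g)\<^sup>2 = ?y \<bullet> (U *v ?g)"
    by (simp add: g power2_norm_eq_inner dot_lmul_matrix)
  also have "\<dots> \<le> norm ?y * norm (U *v ?g)" by (rule norm_cauchy_schwarz)
  also have "\<dots> \<le> norm ?y * (onorm ((*v) U) * norm ?g)"
    by (intro mult_left_mono norm_matrix_vector_le) auto
  finally have *: "norm ?g * norm ?g \<le> (norm ?y * onorm ((*v) U)) * norm ?g"
    by (simp add: power2_eq_square mult_ac)
  have "norm ?g \<le> norm ?y * onorm ((*v) U)"
  proof (cases "norm ?g = 0")
    case True
    then show ?thesis by (simp add: onorm_pos_le)
  next
    case False
    then show ?thesis using * by (simp add: mult_le_cancel_right)
  qed
  then have "(norm ?g)\<^sup>2 \<le> (norm ?y * onorm ((*v) U))\<^sup>2"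
    by (intro power_mono) auto
  then show ?thesis by (simp add: inner_gram power_mult_distrib mult.commute)
qed

text \<open>
  The left side is \<open>trace (G W G)\<close>, and \<open>W\<close> is paired with the nonnegative form \<open>\<parallel>U\<parallel>\<^sup>2 G - G\<^sup>2\<close>.
\<close>
lemma sum_gram_columns_le:
  fixes U :: "real^'m^'n"
  assumes "trace_psd W"
  shows "(\<Sum>j\<in>UNIV. (gram U *v axis j 1) \<bullet> (W *v (gram U *v axis j 1)))
    \<le> (onorm ((*v) U))\<^sup>2 * trace (gram U ** W)"
proof -
  let ?G = "gram U" and ?L = "(onorm ((*v) U))\<^sup>2"
  let ?C = "?L *\<^sub>R ?G - ?G ** ?G"
  have "0 \<le> z \<bullet> (?C *v z)" for z
  proof -
    have "z \<bullet> (?C *v z) = ?L * (z \<bullet> (?G *v z)) - (norm (?G *v z))\<^sup>2"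
      by (simp add: matrix_vector_mult_diff_rdistrib scaleR_matrix_vector_assoc[symmetric]
          matrix_vector_mul_assoc[symmetric] inner_diff_right power2_norm_eq_inner
          inner_symmetric_matrix[OF transpose_gram, of U z "?G *v z", symmetric])
    then show ?thesis using norm_gram_vector_le[of U z] by simp
  qed
  then have "0 \<le> trace (?C ** W)" using assms by (simp add: trace_psd_def)
  moreover have "(\<Sum>j\<in>UNIV. (?G *v axis j 1) \<bullet> (W *v (?G *v axis j 1))) = trace (?G ** (W ** ?G))"
    by (simp add: trace_eq_sum_axis matrix_vector_mul_assoc[symmetric]
        inner_symmetric_matrix[OF transpose_gram])
  moreover have "trace (?G ** (W ** ?G)) = trace (?G ** ?G ** W)"
    by (metis matrix_mul_assoc trace_mul_sym)
  ultimately show ?thesis by (simp add: matrix_distribs trace_sub trace_scaleR)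
qed

text \<open>
  The two barriers are treated at once: \<open>pencil U w (-1)\<close> is \<open>w I - G\<close>, whose positivity on a block
  bounds the largest singular value, and \<open>pencil U (-l) 1\<close> is \<open>G - l I\<close>, for the smallest. In both cases
  increasing the coefficient of the identity moves the barrier away from the spectrum.
\<close>
definition pencil :: "real^'m^'n \<Rightarrow> real \<Rightarrow> real \<Rightarrow> real^'m^'m" where
  "pencil U a c = a *\<^sub>R mat 1 + c *\<^sub>R gram U"

lemma transpose_pencil: "transpose (pencil U a c) = pencil U a c"
  by (simp add: pencil_def transpose_plus transpose_scalar transpose_gram)

lemma pencil_shift: "pencil U a c + \<eta> *\<^sub>R mat 1 = pencil U (a + \<eta>) c"
  by (simp add: pencil_def scaleR_add_left)

lemma inner_pencil: "x \<bullet> (pencil U a c *v x) = a * (norm x)\<^sup>2 + c * (norm (U *v x))\<^sup>2"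
  by (simp add: pencil_def matrix_vector_mult_add_rdistrib scaleR_matrix_vector_assoc[symmetric]
      inner_add_right inner_gram power2_norm_eq_inner)

text \<open>
  Traces of \<open>K R\<close> and \<open>R K R\<close>, expanded by \<open>K = a I + c G\<close>; they express the traces against \<open>G\<close> through
  the traces of \<open>R\<close> and its square alone.
\<close>
lemma trace_pencil_inverse:
  assumes "block_inverse (pencil U a c) \<sigma> R"
  shows "a * trace R + c * trace (gram U ** R) = card \<sigma>"
    and "a * trace (R ** R) + c * trace (gram U ** (R ** R)) = trace R"
    and "0 \<le> trace R" and "0 \<le> trace (R ** R)"
proof -
  let ?K = "pencil U a c" and ?P = "coord_proj \<sigma>"
  have R: "?P ** ?K ** R = ?P" "trace_psd R" "transpose R = R"
    using assms by (auto simp: block_inverse_def)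
  note RP = block_inverse_right[OF assms transpose_pencil]
  have "trace (?K ** R) = trace (?K ** (R ** ?P))" by (simp add: RP)
  also have "\<dots> = trace (?P ** ?K ** R)" by (metis matrix_mul_assoc trace_mul_sym)
  finally have "trace (?K ** R) = card \<sigma>" by (simp add: R trace_coord_proj)
  then show "a * trace R + c * trace (gram U ** R) = card \<sigma>"
    by (simp add: pencil_def matrix_distribs trace_add trace_scaleR)
  have "trace (?K ** (R ** R)) = trace (R ** ?K ** R)"
    by (metis matrix_mul_assoc trace_mul_sym)
  also have "R ** ?K ** R = R" by (rule block_inverse_mult[OF assms assms transpose_pencil])
  finally show "a * trace (R ** R) + c * trace (gram U ** (R ** R)) = trace R"
    by (simp add: pencil_def matrix_distribs trace_add trace_scaleR)
  have "\<forall>z. 0 \<le> z \<bullet> (mat 1 *v z)" by simp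
  then show "0 \<le> trace R" "0 \<le> trace (R ** R)"
    using R(2) trace_psd_square[OF R(3)] unfolding trace_psd_def
    by (metis matrix_mul_lid)+
qed

text \<open>
  The column of \<open>G\<close> at \<open>j\<close> lists the inner products of column \<open>j\<close> of \<open>U\<close> with all columns. Both the
  Schur complement and the growth of the trace on adding \<open>j\<close> are energies of this vector, for the
  block inverse and for its square.
\<close>
definition column_energy :: "real^'m^'n \<Rightarrow> real^'m^'m \<Rightarrow> 'm \<Rightarrow> real" where
  "column_energy U W j = (gram U *v axis j 1) \<bullet> (W *v (gram U *v axis j 1))"

lemma column_energy_nonneg: "trace_psd W \<Longrightarrow> 0 \<le> column_energy U W j"
  unfolding column_energy_def by (rule trace_psd_inner)

lemma column_energy_square:
  assumes "transpose R = R"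
  shows "column_energy U (R ** R) j = (norm (R *v (gram U *v axis j 1)))\<^sup>2"
  by (simp add: column_energy_def matrix_vector_mul_assoc[symmetric] power2_norm_eq_inner
      inner_symmetric_matrix[OF assms, of "gram U *v axis j 1", symmetric])

text \<open>
  Energies are nonnegative, so their sum over any set of columns is at most the sum over all, which
  the operator norm controls. The set \<open>\<tau>\<close> is therefore felt only as the divisor \<open>card \<tau>\<close> when averages are taken.
\<close>
lemma sum_column_energy_le:
  fixes U :: "real^'m^'n"
  assumes "block_inverse (pencil U a c) \<sigma> R" and "c\<^sup>2 = 1"
  shows "(\<Sum>j\<in>\<tau>. column_energy U R j) \<le> (onorm ((*v) U))\<^sup>2 * (c * (card \<sigma> - a * trace R))"
    and "(\<Sum>j\<in>\<tau>. column_energy U (R ** R) j)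
      \<le> (onorm ((*v) U))\<^sup>2 * (c * (trace R - a * trace (R ** R)))"
proof -
  have psd: "trace_psd R" "trace_psd (R ** R)"
    using assms(1) trace_psd_square by (auto simp: block_inverse_def)
  have le: "(\<Sum>j\<in>\<tau>. column_energy U W j) \<le> (onorm ((*v) U))\<^sup>2 * trace (gram U ** W)"
    if "trace_psd W" for W
  proof -
    have "(\<Sum>j\<in>\<tau>. column_energy U W j) \<le> (\<Sum>j\<in>UNIV. column_energy U W j)"
      by (intro sum_mono2) (auto intro: column_energy_nonneg that)
    also have "\<dots> \<le> (onorm ((*v) U))\<^sup>2 * trace (gram U ** W)"
      unfolding column_energy_def by (rule sum_gram_columns_le[OF that])
    finally show ?thesis .
  qed
  have solve: "c * (t - a * x) = y" if "a * x + c * y = t" for t x y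
  proof -
    have "c * (t - a * x) = c\<^sup>2 * y" unfolding that[symmetric] by (simp add: power2_eq_square algebra_simps)
    then show ?thesis by (simp add: assms(2))
  qed
  show "(\<Sum>j\<in>\<tau>. column_energy U R j) \<le> (onorm ((*v) U))\<^sup>2 * (c * (card \<sigma> - a * trace R))"
    using le[OF psd(1)] solve[OF trace_pencil_inverse(1)[OF assms(1)]] by simp
  show "(\<Sum>j\<in>\<tau>. column_energy U (R ** R) j)
      \<le> (onorm ((*v) U))\<^sup>2 * (c * (trace R - a * trace (R ** R)))"
    using le[OF psd(2)] solve[OF trace_pencil_inverse(2)[OF assms(1)]] by simp
qed

text \<open>
  Off the diagonal the new row of the pencil is \<open>c\<close> times that of \<open>G\<close>, and \<open>c\<^sup>2 = 1\<close>; so the upper and the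
  lower barrier lead to the same energies, and differ only in the diagonal entry \<open>a + c\<close>.
\<close>
lemma pencil_add_column:
  fixes U :: "real^'m^'n"
  assumes R: "block_inverse (pencil U a c) \<sigma> R" and c: "c\<^sup>2 = 1" and U: "standardized U"
    and j: "j \<notin> \<sigma>" and less: "column_energy U R j < a + c"
  shows "\<exists>R'. block_inverse (pencil U a c) (insert j \<sigma>) R' \<and>
    trace R' = trace R + (1 + column_energy U (R ** R) j) / (a + c - column_energy U R j)"
proof -
  let ?K = "pencil U a c" and ?e = "axis j 1 :: real^'m"
  let ?g = "gram U *v ?e"
  have sym: "transpose R = R" using R by (simp add: block_inverse_def)
  have RP: "R ** coord_proj \<sigma> = R" by (rule block_inverse_right[OF R transpose_pencil])
  have Re: "R *v ?e = 0"
    by (metis RP j coord_proj_axis_out matrix_vector_mul_assoc matrix_vector_mult_0_right)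
  have h: "?K *v ?e = a *\<^sub>R ?e + c *\<^sub>R ?g"
    by (simp add: pencil_def matrix_vector_mult_add_rdistrib scaleR_matrix_vector_assoc[symmetric])
  have Rh: "R *v (?K *v ?e) = c *\<^sub>R (R *v ?g)"
    unfolding h by (simp add: matrix_vector_right_distrib Re matrix_vector_mult_scaleR)
  have eRg: "?e \<bullet> (R *v ?g) = 0"
    by (simp add: inner_symmetric_matrix[OF sym, of ?e, symmetric] Re)
  have "(?K *v ?e) \<bullet> (R *v (?K *v ?e)) = c\<^sup>2 * column_energy U R j"
    unfolding Rh unfolding h
    by (simp add: inner_add_left eRg column_energy_def power2_eq_square)
  then have q: "(?K *v ?e) \<bullet> (R *v (?K *v ?e)) = column_energy U R j" by (simp add: c)
  have "(norm (R *v (?K *v ?e)))\<^sup>2 = c\<^sup>2 * column_energy U (R ** R) j"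
    unfolding Rh by (simp add: column_energy_square[OF sym] power_mult_distrib)
  then have p: "(norm (R *v (?K *v ?e)))\<^sup>2 = column_energy U (R ** R) j" by (simp add: c)
  have Kjj: "?K $ j $ j = a + c"
    by (simp add: pencil_def gram_diag[OF U] mat_def)
  show ?thesis
    using block_inverse_insert(4,5)[OF R transpose_pencil j] less
    unfolding q p Kjj by fastforce
qed

text \<open>
  A column chosen twice would make the block singular, so its energy is too large for
  a lower barrier \<open>l \<ge> 0\<close> to survive. Averages may therefore run over the columns already chosen too: a
  column that stays within the barriers is automatically a new one.
\<close>
lemma repeated_column_energy:
  fixes U :: "real^'m^'n"
  assumes R: "block_inverse (pencil U (-l) 1) \<sigma> R" and U: "standardized U" and j: "j \<in> \<sigma>"
  shows "1 + l \<le> column_energy U R j"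
proof -
  let ?K = "pencil U (-l) 1" and ?e = "axis j 1 :: real^'m"
  have "R ** ?K ** coord_proj \<sigma> = coord_proj \<sigma>"
    by (rule block_inverse_right[OF R transpose_pencil])
  then have RKe: "R *v (?K *v ?e) = ?e"
    by (metis coord_proj_axis_in j matrix_vector_mul_assoc)
  have sym: "transpose R = R" using R by (simp add: block_inverse_def)
  have g: "gram U *v ?e = ?K *v ?e + l *\<^sub>R ?e"
    by (simp add: pencil_def matrix_vector_mult_diff_rdistrib scaleR_matrix_vector_assoc[symmetric])
  have Rg: "R *v (gram U *v ?e) = ?e + l *\<^sub>R (R *v ?e)"
    unfolding g by (simp add: matrix_vector_right_distrib RKe matrix_vector_mult_scaleR)
  have Ke: "(?K *v ?e) \<bullet> (R *v ?e) = 1"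
    by (metis RKe inner_axis_axis inner_symmetric_matrix[OF sym] inner_real_def mult_1)
  have Kjj: "(?K *v ?e) \<bullet> ?e = 1 - l"
    using gram_diag[OF U, of j]
    by (simp add: inner_commute[of _ ?e] inner_matrix_axis) (simp add: pencil_def mat_def)
  have "column_energy U R j = 1 + l + l\<^sup>2 * (?e \<bullet> (R *v ?e))"
    unfolding column_energy_def Rg unfolding g
    by (simp add: inner_add_left inner_add_right Ke Kjj inner_axis_axis power2_eq_square algebra_simps)
  moreover have "0 \<le> ?e \<bullet> (R *v ?e)"
    using R by (intro trace_psd_inner) (simp add: block_inverse_def)
  ultimately show ?thesis by simp
qed

section \<open>Adding one column between two moving barriers\<close>

text \<open>
  Linearizes the condition on a new column: both fractions have the form \<open>(f / d) / (1 - q / d)\<close>, and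
  \<open>1 - q / d\<close> is at least \<open>1 - (q / d + r / e)\<close>. The hypothesis is linear in \<open>f\<close>, \<open>g\<close>, \<open>q\<close>, \<open>r\<close>, so it can be
  reached by averaging.
\<close>
lemma weighted_increment_le:
  fixes f g d e :: real
  assumes "0 < f" "0 < g" "0 < d" "0 < e" "0 \<le> q" "0 \<le> r"
    and Ypos: "0 < Y" and le: "f / d + g / e + Y * (q / d + r / e) \<le> Y"
  shows "q < d" "r < e" "f / (d - q) + g / (e - r) \<le> Y"
proof -
  let ?Q = "q / d + r / e" and ?P = "f / d + g / e"
  have nn: "0 \<le> q / d" "0 \<le> r / e" "0 \<le> f / d" "0 \<le> g / e" using assms by auto
  have P: "0 < ?P"
    using assms by (simp add: add_pos_pos)
  have Y: "?P \<le> Y * (1 - ?Q)" using le by (simp add: algebra_simps)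
  have Q: "?Q < 1"
  proof (rule ccontr)
    assume "\<not> ?Q < 1"
    then have "Y * (1 - ?Q) \<le> 0" using Ypos by (intro mult_nonneg_nonpos) auto
    then show False using P Y by linarith
  qed
  have q: "q / d < 1" and r: "r / e < 1" using Q nn by linarith+
  then show "q < d" "r < e" using assms by auto
  have "f / (d - q) = (f / d) / (1 - q / d)" using assms \<open>q < d\<close> by (simp add: field_simps)
  also have "\<dots> \<le> (f / d) / (1 - ?Q)" using Q nn by (intro divide_left_mono) auto
  finally have 1: "f / (d - q) \<le> (f / d) / (1 - ?Q)" .
  have "g / (e - r) = (g / e) / (1 - r / e)" using assms \<open>r < e\<close> by (simp add: field_simps)
  also have "\<dots> \<le> (g / e) / (1 - ?Q)" using Q nn by (intro divide_left_mono) auto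
  finally have 2: "g / (e - r) \<le> (g / e) / (1 - ?Q)" .
  have "f / (d - q) + g / (e - r) \<le> ?P / (1 - ?Q)" using 1 2 by (simp add: add_divide_distrib)
  also have "\<dots> \<le> Y" using Y Q by (simp add: pos_divide_le_eq)
  finally show "f / (d - q) + g / (e - r) \<le> Y" .
qed

text \<open>
  The potential is \<open>\<alpha> trace R + \<beta> trace S\<close>, for the inverses at the upper barrier \<open>w\<close> and the lower
  barrier \<open>l\<close>. The weights bound \<open>w' / (w' - 1)\<close> and \<open>l' / (1 - l')\<close>, so that the average over \<open>\<tau>\<close> of the
  normalized energies \<open>A j\<close> below is at most \<open>\<theta>\<close> times the potential, up to the term bounded by
  \<open>size\<close>; here \<open>\<theta>\<close> is the average share of \<open>\<parallel>U\<parallel>\<^sup>2\<close> per column. The average is then at most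
  \<open>1/2 + 1/6 = 2/3\<close>, which leaves the factor \<open>1/3\<close> in the denominators: this is the origin of every \<open>3\<close> in
  the shifts and in the increment. The shifts are chosen so that the gain from moving the barriers
  cancels the traces of squares in the bound for the growth of the potential; what remains is the
  constant increment of the conclusion.
\<close>
lemma exists_column_within_barriers:
  fixes U :: "real^'m^'n" and \<tau> \<sigma> :: "'m set" and \<theta> :: real
  assumes U: "standardized U" and \<tau>: "\<tau> \<noteq> {}"
    and L: "(onorm ((*v) U))\<^sup>2 = \<theta> * card \<tau>" and \<theta>: "0 < \<theta>"
    and R: "block_inverse (pencil U w (-1)) \<sigma> R"
    and S: "block_inverse (pencil U (-l) 1) \<sigma> S"
    and \<alpha>: "0 < \<alpha>" and \<beta>: "0 < \<beta>" and a: "0 < a" and b: "0 < b"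
    and w': "w' = w + 3 * \<theta> * \<alpha>" "a \<le> w' - 1" "w' / (w' - 1) \<le> \<alpha>"
    and l': "l' = l - 3 * \<theta> * \<beta>" "b \<le> 1 - l'" "l' / (1 - l') \<le> \<beta>" "0 \<le> l'"
    and pot: "\<theta> * (\<alpha> * trace R + \<beta> * trace S) \<le> 1 / 2"
    and size: "\<theta> * card \<sigma> / b \<le> 1 / 6"
  shows "\<exists>j\<in>\<tau> - \<sigma>. \<exists>R' S'.
    block_inverse (pencil U w' (-1)) (insert j \<sigma>) R' \<and>
    block_inverse (pencil U (-l') 1) (insert j \<sigma>) S' \<and>
    \<alpha> * trace R' + \<beta> * trace S' \<le>
      \<alpha> * trace R + \<beta> * trace S + 3 * (\<alpha> / a + (\<beta> + 1 / 2) / b)"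
proof -
  let ?k = "real (card \<tau>)" and ?s = "real (card \<sigma>)"
  have k: "0 < ?k" using \<tau> by (simp add: card_gt_0_iff)
  obtain R1 where R1: "block_inverse (pencil U w' (-1)) \<sigma> R1"
    and shiftR: "trace R1 + 3 * \<theta> * \<alpha> * trace (R1 ** R1) \<le> trace R"
    using block_inverse_shift[OF R transpose_pencil, of "3 * \<theta> * \<alpha>"] \<theta> \<alpha>
    unfolding pencil_shift w'(1) by auto
  obtain S1 where S1: "block_inverse (pencil U (-l') 1) \<sigma> S1"
    and shiftS: "trace S1 + 3 * \<theta> * \<beta> * trace (S1 ** S1) \<le> trace S"
    using block_inverse_shift[OF S transpose_pencil, of "3 * \<theta> * \<beta>"] \<theta> \<beta>
    unfolding pencil_shift l'(1) by auto
  define x x2 y y2 where "x = trace R1" and "x2 = trace (R1 ** R1)"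
    and "y = trace S1" and "y2 = trace (S1 ** S1)"
  note defs = x_def x2_def y_def y2_def
  have nn: "0 \<le> x" "0 \<le> x2" "0 \<le> y" "0 \<le> y2"
    unfolding defs by (intro trace_pencil_inverse(3,4)[OF R1] trace_pencil_inverse(3,4)[OF S1])+
  define qR pR qS pS where "qR j = column_energy U R1 j"
    and "pR j = column_energy U (R1 ** R1) j"
    and "qS j = column_energy U S1 j"
    and "pS j = column_energy U (S1 ** S1) j" for j
  note edefs = qR_def pR_def qS_def pS_def
  have psd: "trace_psd R1" "trace_psd (R1 ** R1)" "trace_psd S1" "trace_psd (S1 ** S1)"
    using R1 S1 trace_psd_square unfolding block_inverse_def by auto
  have enn: "0 \<le> qR j" "0 \<le> pR j" "0 \<le> qS j" "0 \<le> pS j" for j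
    unfolding edefs by (intro column_energy_nonneg psd)+
  define L where "L = \<theta> * ?k"
  have Lpos: "0 < L" using \<theta> k by (simp add: L_def)
  have sums: "(\<Sum>j\<in>\<tau>. qR j) \<le> L * (w' * x)" "(\<Sum>j\<in>\<tau>. pR j) \<le> L * (w' * x2)"
    "(\<Sum>j\<in>\<tau>. qS j) \<le> L * (l' * y + ?s)" "(\<Sum>j\<in>\<tau>. pS j) \<le> L * (l' * y2 + y)"
  proof -
    have "(\<Sum>j\<in>\<tau>. qR j) \<le> L * (w' * x - ?s)" "(\<Sum>j\<in>\<tau>. pR j) \<le> L * (w' * x2 - x)"
      using sum_column_energy_le[OF R1, of \<tau>] unfolding edefs defs L L_def by auto
    moreover have "L * (w' * x - ?s) \<le> L * (w' * x)" "L * (w' * x2 - x) \<le> L * (w' * x2)"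
      using Lpos nn by (auto intro!: mult_left_mono)
    ultimately show "(\<Sum>j\<in>\<tau>. qR j) \<le> L * (w' * x)" "(\<Sum>j\<in>\<tau>. pR j) \<le> L * (w' * x2)"
      by linarith+
    show "(\<Sum>j\<in>\<tau>. qS j) \<le> L * (l' * y + ?s)" "(\<Sum>j\<in>\<tau>. pS j) \<le> L * (l' * y2 + y)"
      using sum_column_energy_le[OF S1, of \<tau>] unfolding edefs defs L L_def
      by (auto simp: algebra_simps)
  qed
  let ?d = "w' - 1" and ?e = "1 - l'"
  have d: "0 < ?d" and e: "0 < ?e" using w' l' a b by auto
  define A where "A j = qR j / ?d + qS j / ?e" for j
  define B where "B j = \<alpha> * (1 + pR j) / ?d + \<beta> * (1 + pS j) / ?e" for j
  have pot1: "\<theta> * (\<alpha> * x + \<beta> * y) \<le> 1 / 2"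
  proof -
    have "0 \<le> 3 * \<theta> * \<alpha> * x2" "0 \<le> 3 * \<theta> * \<beta> * y2" using \<theta> \<alpha> \<beta> nn by auto
    then have "x \<le> trace R" "y \<le> trace S" using shiftR shiftS unfolding defs by linarith+
    then have "\<theta> * (\<alpha> * x + \<beta> * y) \<le> \<theta> * (\<alpha> * trace R + \<beta> * trace S)"
      using \<theta> \<alpha> \<beta> by (intro mult_left_mono add_mono) auto
    then show ?thesis using pot by linarith
  qed
  have muy: "\<theta> * \<beta> * y \<le> 1 / 2"
  proof -
    have "0 \<le> \<theta> * (\<alpha> * x)" using \<theta> \<alpha> nn by auto
    then show ?thesis using pot1 by (simp add: algebra_simps)
  qed
  have sA: "(\<Sum>j\<in>\<tau>. A j) \<le> ?k * (2 / 3)"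
  proof -
    have "(\<Sum>j\<in>\<tau>. A j) = (\<Sum>j\<in>\<tau>. qR j) / ?d + (\<Sum>j\<in>\<tau>. qS j) / ?e"
      by (simp add: A_def sum.distrib sum_divide_distrib)
    also have "\<dots> \<le> L * (w' * x) / ?d + L * (l' * y + ?s) / ?e"
      using sums d e by (intro add_mono divide_right_mono) auto
    also have "\<dots> = L * ((w' / ?d) * x + (l' / ?e) * y + ?s / ?e)"
      by (simp add: add_divide_distrib algebra_simps)
    also have "\<dots> \<le> L * (\<alpha> * x + \<beta> * y + ?s / b)"
      using Lpos nn w' l' e b by (intro mult_left_mono add_mono mult_right_mono divide_left_mono) auto
    also have "\<dots> = ?k * (\<theta> * (\<alpha> * x + \<beta> * y) + \<theta> * ?s / b)"
      by (simp add: L_def algebra_simps)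
    also have "\<dots> \<le> ?k * (2 / 3)"
    proof (rule mult_left_mono)
      show "\<theta> * (\<alpha> * x + \<beta> * y) + \<theta> * ?s / b \<le> 2 / 3" using pot1 size by linarith
    qed (use k in simp)
    finally show ?thesis .
  qed
  \<comment> \<open>The increment claimed for the potential, plus what was gained by the two shifts.\<close>
  define Y where "Y = 3 * (\<alpha> / a + (\<beta> + 1 / 2) / b) + 3 * \<theta> * \<alpha>\<^sup>2 * x2 + 3 * \<theta> * \<beta>\<^sup>2 * y2"
  have Ypos: "0 < Y"
    unfolding Y_def using \<alpha> \<beta> \<theta> a b nn by (intro add_pos_nonneg) (auto intro!: add_pos_pos)
  have sB: "(\<Sum>j\<in>\<tau>. B j) \<le> ?k * (Y / 3)"
  proof -
    have "(\<Sum>j\<in>\<tau>. B j) = \<alpha> * (?k + (\<Sum>j\<in>\<tau>. pR j)) / ?d + \<beta> * (?k + (\<Sum>j\<in>\<tau>. pS j)) / ?e"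
      by (simp add: B_def sum.distrib sum_divide_distrib[symmetric] sum_distrib_left[symmetric])
    also have "\<dots> \<le> \<alpha> * (?k + L * (w' * x2)) / ?d + \<beta> * (?k + L * (l' * y2 + y)) / ?e"
      using sums d e \<alpha> \<beta> by (intro add_mono divide_right_mono mult_left_mono) auto
    also have "\<dots> = ?k * (\<alpha> / ?d + \<beta> / ?e + \<theta> * \<alpha> * x2 * (w' / ?d)
        + \<theta> * \<beta> * y2 * (l' / ?e) + \<theta> * \<beta> * y / ?e)"
      by (simp add: L_def add_divide_distrib algebra_simps)
    also have "\<dots> \<le> ?k * (\<alpha> / a + \<beta> / b + \<theta> * \<alpha> * x2 * \<alpha> + \<theta> * \<beta> * y2 * \<beta> + (1 / 2) / b)"
      using k nn w' l' d e a b \<theta> \<alpha> \<beta> muy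
      by (intro mult_left_mono add_mono divide_left_mono frac_le) auto
    also have "\<dots> = ?k * (Y / 3)"
      by (simp add: Y_def power2_eq_square add_divide_distrib algebra_simps)
    finally show ?thesis .
  qed
  \<comment> \<open>The averages of \<open>B\<close> and of \<open>Y * A\<close> over \<open>\<tau>\<close> are at most \<open>Y / 3\<close> and \<open>2 * Y / 3\<close>.\<close>
  have "\<exists>j\<in>\<tau>. B j + Y * A j \<le> Y"
  proof (rule ccontr)
    assume "\<not> ?thesis"
    then have "(\<Sum>j\<in>\<tau>. Y) < (\<Sum>j\<in>\<tau>. B j + Y * A j)"
      using \<tau> by (intro sum_strict_mono) auto
    also have "\<dots> = (\<Sum>j\<in>\<tau>. B j) + Y * (\<Sum>j\<in>\<tau>. A j)"
      by (simp add: sum.distrib sum_distrib_left)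
    also have "\<dots> \<le> ?k * (Y / 3) + Y * (?k * (2 / 3))"
      using sA sB Ypos by (intro add_mono mult_left_mono) auto
    finally show False by simp
  qed
  then obtain j where j: "j \<in> \<tau>" and jle: "B j + Y * A j \<le> Y" by blast
  have num: "0 < \<alpha> * (1 + pR j)" "0 < \<beta> * (1 + pS j)"
    using enn[of j] \<alpha> \<beta> by (auto intro!: mult_pos_pos add_pos_nonneg)
  note inc = weighted_increment_le[OF num d e enn(1,3) Ypos jle[unfolded A_def B_def]]
  have "j \<notin> \<sigma>"
    using repeated_column_energy[OF S1 U, of j] inc(2) l'(4) unfolding qS_def by fastforce
  obtain R2 where R2: "block_inverse (pencil U w' (-1)) (insert j \<sigma>) R2"
    "trace R2 = x + (1 + pR j) / (?d - qR j)"
    using pencil_add_column[OF R1 _ U \<open>j \<notin> \<sigma>\<close>] inc(1) unfolding edefs defs by auto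
  obtain S2 where S2: "block_inverse (pencil U (-l') 1) (insert j \<sigma>) S2"
    "trace S2 = y + (1 + pS j) / (?e - qS j)"
    using pencil_add_column[OF S1 _ U \<open>j \<notin> \<sigma>\<close>] inc(2) unfolding edefs defs
    by (auto simp: algebra_simps)
  have "\<alpha> * trace R2 + \<beta> * trace S2 \<le> \<alpha> * x + \<beta> * y + Y"
    using inc(3) by (simp add: R2(2) S2(2) distrib_left)
  also have "\<dots> = \<alpha> * (x + 3 * \<theta> * \<alpha> * x2) + \<beta> * (y + 3 * \<theta> * \<beta> * y2)
      + 3 * (\<alpha> / a + (\<beta> + 1 / 2) / b)"
    by (simp add: Y_def power2_eq_square algebra_simps)
  also have "\<dots> \<le> \<alpha> * trace R + \<beta> * trace S + 3 * (\<alpha> / a + (\<beta> + 1 / 2) / b)"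
    using shiftR shiftS \<alpha> \<beta> unfolding defs by (intro add_mono mult_left_mono) auto
  finally show ?thesis using j \<open>j \<notin> \<sigma>\<close> R2(1) S2(1) by blast
qed

section \<open>A large subset of columns that is nearly isometric\<close>

text \<open>
  The barriers start at \<open>1 + a\<close> and \<open>1 - b\<close>, and together they use the weights \<open>(1 + a) / a\<close> and
  \<open>(1 - b) / b\<close>. The starting points are the midpoints of \<open>1 + \<epsilon>\<close> and \<open>(1 + \<epsilon>)\<^sup>2\<close>, respectively of \<open>1 - \<epsilon>\<close> and
  \<open>(1 - \<epsilon>)\<^sup>2\<close>: a start closer to \<open>1\<close> makes the potential grow too fast, one closer to the
  end leaves no room for the shifts. The number \<open>\<epsilon>\<^sup>2 / 9\<close> is the total budget for \<open>\<theta>\<close> times the number of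
  steps; it keeps both barriers short of their ends, the potential at most \<open>1/2\<close>, and the size term at most
  \<open>1/6\<close>.
\<close>
lemma barrier_constants:
  fixes \<epsilon> :: real
  assumes \<epsilon>: "0 < \<epsilon>" "\<epsilon> < 1"
  defines "a \<equiv> \<epsilon> * (3 + \<epsilon>) / 2" and "b \<equiv> \<epsilon> * (3 - \<epsilon>) / 2"
  shows "0 < a" "0 < b" "b < 1"
    and "1 + a + 3 * (\<epsilon>\<^sup>2 / 9) * ((1 + a) / a) \<le> (1 + \<epsilon>)\<^sup>2"
    and "(1 - \<epsilon>)\<^sup>2 \<le> 1 - b - 3 * (\<epsilon>\<^sup>2 / 9) * ((1 - b) / b)"
    and "\<epsilon>\<^sup>2 / 9 * (3 * ((1 + a) / a / a + ((1 - b) / b + 1 / 2) / b)) \<le> 1 / 2"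
    and "\<epsilon>\<^sup>2 / 9 / b \<le> 1 / 6"
proof -
  show a: "0 < a" and b: "0 < b" using \<epsilon> by (auto simp: a_def b_def)
  have a1: "1 + a = (1 + \<epsilon>) * (2 + \<epsilon>) / 2" by (simp add: a_def algebra_simps)
  have b1: "1 - b = (1 - \<epsilon>) * (2 - \<epsilon>) / 2" by (simp add: b_def field_simps)
  have "0 < 1 - b" unfolding b1 using \<epsilon> by simp
  then show "b < 1" by simp
  have cancel: "3 * (\<epsilon>\<^sup>2 / 9) * ((p * q / 2) / (\<epsilon> * r / 2)) = \<epsilon> * p / 3 * (q / r)"
    "\<epsilon>\<^sup>2 * (p / (\<epsilon> * r / 2) / (\<epsilon> * r / 2)) = 4 * p / r\<^sup>2" if "0 < r" for p q r
    using \<epsilon> that by (simp_all add: power2_eq_square)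
  have "3 * (\<epsilon>\<^sup>2 / 9) * ((1 + a) / a) = \<epsilon> * (1 + \<epsilon>) / 3 * ((2 + \<epsilon>) / (3 + \<epsilon>))"
    unfolding a1 unfolding a_def using \<epsilon> by (intro cancel) simp
  also have "\<dots> \<le> \<epsilon> * (1 + \<epsilon>) / 3 * 1" using \<epsilon> by (intro mult_left_mono) auto
  also have "\<dots> \<le> \<epsilon> * (1 + \<epsilon>) / 2" using \<epsilon> by simp
  finally show "1 + a + 3 * (\<epsilon>\<^sup>2 / 9) * ((1 + a) / a) \<le> (1 + \<epsilon>)\<^sup>2"
    by (simp add: a_def power2_eq_square field_simps)
  have "3 * (\<epsilon>\<^sup>2 / 9) * ((1 - b) / b) = \<epsilon> * (1 - \<epsilon>) / 3 * ((2 - \<epsilon>) / (3 - \<epsilon>))"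
    unfolding b1 unfolding b_def using \<epsilon> by (intro cancel) simp
  also have "\<dots> \<le> \<epsilon> * (1 - \<epsilon>) / 3 * 1" using \<epsilon> by (intro mult_left_mono) auto
  also have "\<dots> \<le> \<epsilon> * (1 - \<epsilon>) / 2" using \<epsilon> by simp
  finally show "(1 - \<epsilon>)\<^sup>2 \<le> 1 - b - 3 * (\<epsilon>\<^sup>2 / 9) * ((1 - b) / b)"
    by (simp add: b_def power2_eq_square field_simps)
  have e2: "\<epsilon>\<^sup>2 \<le> \<epsilon>" "\<epsilon>\<^sup>2 \<le> 1" using \<epsilon> by (auto simp: power2_eq_square mult_le_one)
  have "\<epsilon>\<^sup>2 * ((1 + a) / a / a) = 4 * ((1 + \<epsilon>) * (2 + \<epsilon>) / 2) / (3 + \<epsilon>)\<^sup>2"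
    unfolding a1 unfolding a_def using \<epsilon> by (intro cancel) simp
  also have "\<dots> \<le> 3 / 4"
  proof -
    have "3 / 4 * (3 + \<epsilon>)\<^sup>2 - 4 * ((1 + \<epsilon>) * (2 + \<epsilon>) / 2) = (11 - 6 * \<epsilon> - 5 * \<epsilon>\<^sup>2) / 4"
      by (simp add: power2_eq_square field_simps)
    moreover have "0 \<le> (11 - 6 * \<epsilon> - 5 * \<epsilon>\<^sup>2) / 4" using \<epsilon> e2 by simp
    ultimately have "4 * ((1 + \<epsilon>) * (2 + \<epsilon>) / 2) \<le> 3 / 4 * (3 + \<epsilon>)\<^sup>2"
      by (metis diff_ge_0_iff_ge)
    then show ?thesis using \<epsilon> by (subst pos_divide_le_eq) simp_all
  qed
  finally have 1: "\<epsilon>\<^sup>2 * ((1 + a) / a / a) \<le> 3 / 4" .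
  have "(1 - b) / b + 1 / 2 = (1 - b / 2) / b" using b by (simp add: field_simps)
  then have "\<epsilon>\<^sup>2 * (((1 - b) / b + 1 / 2) / b) = \<epsilon>\<^sup>2 * ((1 - b / 2) / b / b)" by simp
  also have "\<dots> = 4 * (1 - b / 2) / (3 - \<epsilon>)\<^sup>2"
    unfolding b_def using \<epsilon> by (intro cancel) simp
  also have "\<dots> = (4 - 3 * \<epsilon> + \<epsilon>\<^sup>2) / (3 - \<epsilon>)\<^sup>2"
  proof -
    have "4 * (1 - b / 2) = 4 - 3 * \<epsilon> + \<epsilon>\<^sup>2"
      by (simp add: b_def power2_eq_square field_simps)
    then show ?thesis by simp
  qed
  also have "\<dots> \<le> 1 / 2"
  proof -
    have "1 / 2 * (3 - \<epsilon>)\<^sup>2 - (4 - 3 * \<epsilon> + \<epsilon>\<^sup>2) = (1 - \<epsilon>\<^sup>2) / 2"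
      by (simp add: power2_eq_square field_simps)
    moreover have "0 \<le> (1 - \<epsilon>\<^sup>2) / 2" using e2 by simp
    ultimately have "4 - 3 * \<epsilon> + \<epsilon>\<^sup>2 \<le> 1 / 2 * (3 - \<epsilon>)\<^sup>2"
      by (metis diff_ge_0_iff_ge)
    then show ?thesis using \<epsilon> by (subst pos_divide_le_eq) simp_all
  qed
  finally have 2: "\<epsilon>\<^sup>2 * (((1 - b) / b + 1 / 2) / b) \<le> 1 / 2" .
  show "\<epsilon>\<^sup>2 / 9 * (3 * ((1 + a) / a / a + ((1 - b) / b + 1 / 2) / b)) \<le> 1 / 2"
  proof -
    have distrib: "\<epsilon>\<^sup>2 / 9 * (3 * (x + y)) = (\<epsilon>\<^sup>2 * x + \<epsilon>\<^sup>2 * y) / 3" for x y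
      by (simp add: field_simps)
    have "(x + y) / 3 \<le> 1 / 2" if "x \<le> 3 / 4" "y \<le> 1 / 2" for x y :: real
      using that by simp
    from this[OF 1 2] show ?thesis unfolding distrib .
  qed
  have "\<epsilon>\<^sup>2 / 9 / b = 2 * \<epsilon> / (9 * (3 - \<epsilon>))"
    using \<epsilon> by (simp add: b_def power2_eq_square field_simps)
  also have "\<dots> \<le> 1 / 6" using \<epsilon> by (simp add: field_simps)
  finally show "\<epsilon>\<^sup>2 / 9 / b \<le> 1 / 6" .
qed

lemma onorm_ge_1_of_standardized:
  fixes U :: "real^'m^'n"
  assumes "standardized U"
  shows "1 \<le> onorm ((*v) U)"
  using norm_matrix_vector_le[of U "axis undefined 1"] assms
  by (simp add: standardized_def matrix_vector_mult_basis)

definition near_isometry_on :: "real^'m^'n \<Rightarrow> real \<Rightarrow> 'm set \<Rightarrow> bool" where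
  "near_isometry_on U \<epsilon> \<sigma> \<longleftrightarrow> (\<forall>x\<in>coord_space \<sigma>.
     (1 - \<epsilon>) * norm x \<le> norm (U *v x) \<and> norm (U *v x) \<le> (1 + \<epsilon>) * norm x)"

text \<open>
  Columns are added one by one from the empty set, where the potential is \<open>0\<close>, until \<open>\<epsilon>\<^sup>2 / (9 \<theta>)\<close> of them
  are chosen. The barriers then still lie
  between \<open>(1 - \<epsilon>)\<^sup>2\<close> and \<open>(1 + \<epsilon>)\<^sup>2\<close>.
\<close>
lemma exists_large_near_isometry:
  fixes U :: "real^'m^'n" and \<tau> :: "'m set"
  assumes U: "standardized U" and \<tau>: "\<tau> \<noteq> {}" and \<epsilon>: "0 < \<epsilon>" "\<epsilon> < 1"
  shows "\<exists>\<sigma>\<subseteq>\<tau>. \<sigma> \<noteq> {} \<and> \<epsilon>\<^sup>2 / (9 * (onorm ((*v) U))\<^sup>2) * card \<tau> \<le> card \<sigma> \<and>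
    near_isometry_on U \<epsilon> \<sigma>"
proof -
  define L where "L = (onorm ((*v) U))\<^sup>2"
  define \<theta> where "\<theta> = L / card \<tau>"
  have k: "0 < real (card \<tau>)" using \<tau> by (simp add: card_gt_0_iff)
  have "1 \<le> L" using onorm_ge_1_of_standardized[OF U] by (simp add: L_def)
  then have \<theta>: "0 < \<theta>" unfolding \<theta>_def using k by (intro divide_pos_pos) auto
  have L\<theta>: "(onorm ((*v) U))\<^sup>2 = \<theta> * card \<tau>" using \<tau> by (simp add: \<theta>_def L_def)
  define a b where "a = \<epsilon> * (3 + \<epsilon>) / 2" and "b = \<epsilon> * (3 - \<epsilon>) / 2"
  note const = barrier_constants[OF \<epsilon>, folded a_def b_def]
  define \<alpha> \<beta> where "\<alpha> = (1 + a) / a" and "\<beta> = (1 - b) / b"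
  have pos: "0 < \<alpha>" "0 < \<beta>" using const(1-3) by (auto simp: \<alpha>_def \<beta>_def)
  note const' = const(4-7)[folded \<alpha>_def \<beta>_def]
  define \<rho> where "\<rho> = 3 * (\<alpha> / a + (\<beta> + 1 / 2) / b)"
  have \<rho>: "0 < \<rho>" unfolding \<rho>_def using pos const(1,2) by (auto intro!: add_pos_pos)
  \<comment> \<open>The offset \<open>s - 1\<close>, taken in the reals, makes the first step end exactly at the starting barriers,
    so that \<open>N\<close> steps cost only \<open>N - 1\<close> shifts and rounding \<open>N\<close> up stays within the budget.\<close>
  define w l where "w s = 1 + a + (real s - 1) * (3 * \<theta> * \<alpha>)"
    and "l s = 1 - b - (real s - 1) * (3 * \<theta> * \<beta>)" for s :: nat
  define N where "N = nat \<lceil>\<epsilon>\<^sup>2 / 9 / \<theta>\<rceil>"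
  have "0 < \<epsilon>\<^sup>2 / 9 / \<theta>" using \<theta> \<epsilon> by simp
  then have N: "0 < N" and N_ge: "\<epsilon>\<^sup>2 / 9 / \<theta> \<le> N" and N_less: "real N - 1 < \<epsilon>\<^sup>2 / 9 / \<theta>"
    unfolding N_def by linarith+
  have budget: "real s * \<theta> \<le> \<epsilon>\<^sup>2 / 9" if "s < N" for s
  proof -
    have "real s \<le> \<epsilon>\<^sup>2 / 9 / \<theta>" using that N_less by linarith
    then show ?thesis using \<theta> by (simp add: pos_le_divide_eq)
  qed
  have wl: "1 + a \<le> w (Suc s)" "w (Suc s) \<le> (1 + \<epsilon>)\<^sup>2" "l (Suc s) \<le> 1 - b" "(1 - \<epsilon>)\<^sup>2 \<le> l (Suc s)"
    if "s < N" for s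
  proof -
    have "(real s * \<theta>) * (3 * \<alpha>) \<le> \<epsilon>\<^sup>2 / 9 * (3 * \<alpha>)" "(real s * \<theta>) * (3 * \<beta>) \<le> \<epsilon>\<^sup>2 / 9 * (3 * \<beta>)"
      using budget[OF that] pos by (auto intro!: mult_right_mono)
    then show "w (Suc s) \<le> (1 + \<epsilon>)\<^sup>2" "(1 - \<epsilon>)\<^sup>2 \<le> l (Suc s)"
      using const'(1,2) by (auto simp: w_def l_def mult_ac)
    show "1 + a \<le> w (Suc s)" "l (Suc s) \<le> 1 - b"
      using \<theta> pos by (auto simp: w_def l_def)
  qed
  have "\<exists>\<sigma>\<subseteq>\<tau>. card \<sigma> = s \<and> (\<exists>R S. block_inverse (pencil U (w s) (-1)) \<sigma> R \<and>
      block_inverse (pencil U (- l s) 1) \<sigma> S \<and> \<alpha> * trace R + \<beta> * trace S \<le> \<rho> * s)"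
    if "s \<le> N" for s
    using that
  proof (induction s)
    case 0
    have "\<alpha> * trace (0::real^'m^'m) + \<beta> * trace (0::real^'m^'m) \<le> \<rho> * real 0"
      by (simp add: trace_def)
    then show ?case using block_inverse_empty by (intro exI[of _ "{}"]) auto
  next
    case (Suc s)
    then obtain \<sigma> R S where \<sigma>: "\<sigma> \<subseteq> \<tau>" "card \<sigma> = s"
      and R: "block_inverse (pencil U (w s) (-1)) \<sigma> R"
      and S: "block_inverse (pencil U (- l s) 1) \<sigma> S"
      and T: "\<alpha> * trace R + \<beta> * trace S \<le> \<rho> * s" by auto
    have s: "s < N" using Suc.prems by simp
    note wl = wl[OF s]
    have "\<theta> * (\<alpha> * trace R + \<beta> * trace S) \<le> \<theta> * (\<rho> * s)"
      using T \<theta> by (intro mult_left_mono) auto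
    also have "\<dots> = (real s * \<theta>) * \<rho>" by simp
    also have "\<dots> \<le> \<epsilon>\<^sup>2 / 9 * \<rho>" using budget[OF s] \<rho> by (intro mult_right_mono) auto
    also have "\<dots> \<le> 1 / 2" using const'(3) by (simp add: \<rho>_def)
    finally have pot: "\<theta> * (\<alpha> * trace R + \<beta> * trace S) \<le> 1 / 2" .
    have "\<theta> * card \<sigma> / b \<le> \<epsilon>\<^sup>2 / 9 / b"
      using budget[OF s] const(2) by (intro divide_right_mono) (auto simp: \<sigma>(2) mult.commute)
    then have size: "\<theta> * card \<sigma> / b \<le> 1 / 6" using const'(4) by linarith
    have w': "w (Suc s) = w s + 3 * \<theta> * \<alpha>" "a \<le> w (Suc s) - 1"
      by (simp add: w_def algebra_simps) (use wl(1) in simp)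
    have w'': "w (Suc s) / (w (Suc s) - 1) \<le> \<alpha>"
      using w'(2) const(1) by (simp add: \<alpha>_def field_simps)
    have l': "l (Suc s) = l s - 3 * \<theta> * \<beta>" "b \<le> 1 - l (Suc s)"
      by (simp add: l_def algebra_simps) (use wl(3) in simp)
    have "0 \<le> (1 - \<epsilon>)\<^sup>2" by simp
    then have l0: "0 \<le> l (Suc s)" using wl(4) by linarith
    have l'': "l (Suc s) / (1 - l (Suc s)) \<le> \<beta>"
      using l'(2) const(2) by (simp add: \<beta>_def field_simps)
    obtain j R' S' where j: "j \<in> \<tau> - \<sigma>"
      and R': "block_inverse (pencil U (w (Suc s)) (-1)) (insert j \<sigma>) R'"
      and S': "block_inverse (pencil U (- l (Suc s)) 1) (insert j \<sigma>) S'"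
      and T': "\<alpha> * trace R' + \<beta> * trace S' \<le> \<alpha> * trace R + \<beta> * trace S + \<rho>"
      using exists_column_within_barriers[OF U \<tau> L\<theta> \<theta> R S pos const(1,2) w' w'' l' l'' l0
        pot size] unfolding \<rho>_def by blast
    have "\<alpha> * trace R' + \<beta> * trace S' \<le> \<rho> * real (Suc s)"
      using T T' by (simp add: distrib_left)
    moreover have "insert j \<sigma> \<subseteq> \<tau>" using j \<sigma>(1) by blast
    moreover have "card (insert j \<sigma>) = Suc s" using j \<sigma>(2) by (simp add: card_insert_disjoint)
    ultimately show ?case using R' S'
      by (intro exI[of _ "insert j \<sigma>"] exI[of _ R'] exI[of _ S'] conjI)
  qed
  from this[OF order_refl] obtain \<sigma> R S where \<sigma>: "\<sigma> \<subseteq> \<tau>" "card \<sigma> = N"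
    and R: "block_inverse (pencil U (w N) (-1)) \<sigma> R"
    and S: "block_inverse (pencil U (- l N) 1) \<sigma> S" by blast
  have wlN: "w N \<le> (1 + \<epsilon>)\<^sup>2" "(1 - \<epsilon>)\<^sup>2 \<le> l N"
    using wl(2,4)[of "N - 1"] N by auto
  have "near_isometry_on U \<epsilon> \<sigma>"
    unfolding near_isometry_on_def
  proof (intro ballI conjI)
    fix x :: "real^'m"
    assume x: "x \<in> coord_space \<sigma>"
    have "(norm (U *v x))\<^sup>2 \<le> w N * (norm x)\<^sup>2"
      using block_inverse_nonneg[OF R transpose_pencil x] by (simp add: inner_pencil)
    also have "\<dots> \<le> (1 + \<epsilon>)\<^sup>2 * (norm x)\<^sup>2" using wlN by (intro mult_right_mono) auto
    finally have "(norm (U *v x))\<^sup>2 \<le> ((1 + \<epsilon>) * norm x)\<^sup>2"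
      by (simp only: power_mult_distrib)
    then show "norm (U *v x) \<le> (1 + \<epsilon>) * norm x"
      by (rule power2_le_imp_le) (use \<epsilon> in simp)
    have "(1 - \<epsilon>)\<^sup>2 * (norm x)\<^sup>2 \<le> l N * (norm x)\<^sup>2" using wlN by (intro mult_right_mono) auto
    also have "\<dots> \<le> (norm (U *v x))\<^sup>2"
      using block_inverse_nonneg[OF S transpose_pencil x] by (simp add: inner_pencil)
    finally have "((1 - \<epsilon>) * norm x)\<^sup>2 \<le> (norm (U *v x))\<^sup>2"
      by (simp only: power_mult_distrib)
    then show "(1 - \<epsilon>) * norm x \<le> norm (U *v x)"
      by (rule power2_le_imp_le) simp
  qed
  moreover have "\<epsilon>\<^sup>2 / (9 * (onorm ((*v) U))\<^sup>2) * card \<tau> \<le> card \<sigma>"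
    using N_ge unfolding \<sigma>(2) by (simp add: \<theta>_def L_def)
  moreover have "\<sigma> \<noteq> {}" using \<sigma>(2) N by auto
  ultimately show ?thesis using \<sigma>(1) by blast
qed

section \<open>Greedy partition\<close>

lemma half_le_ln_2: "1 / 2 \<le> ln (2::real)"
proof -
  have "exp (1 / 2 :: real) ^ 2 = exp 1" by (simp add: exp_double[symmetric])
  also have "\<dots> \<le> 2 ^ 2" using exp_le by simp
  finally have "exp (1 / 2 :: real) \<le> 2" by (rule power2_le_imp_le) simp
  then show ?thesis by (subst ln_ge_iff) simp_all
qed

text \<open>
  Each selected set removes at least the fraction \<open>c\<close> of what is left, and \<open>ln (1 - c) \<le> - c\<close>, so every set
  costs \<open>c\<close> of the logarithm of the number of remaining elements. The logarithm cannot pay for the last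
  sets; there one counts that the parts are at most as many as the elements, and
  \<open>k \<le> ln k / c\<close> as long as \<open>c k \<le> 1\<close> and \<open>k \<ge> 3\<close>, while \<open>2 \<le> ln 2 / c\<close> since \<open>c \<le> 1/9\<close>.
\<close>
lemma greedy_partition:
  fixes T :: "'a set" and c :: real
  assumes "finite T" and c: "0 < c" "c \<le> 1 / 9"
    and select: "\<And>\<tau>. \<tau> \<subseteq> T \<Longrightarrow> \<tau> \<noteq> {} \<Longrightarrow> \<exists>\<sigma>\<subseteq>\<tau>. \<sigma> \<noteq> {} \<and> c * card \<tau> \<le> card \<sigma> \<and> good \<sigma>"
  shows "\<exists>P. partition_on T P \<and> card P \<le> card T \<and>
    (2 \<le> card T \<longrightarrow> real (card P) \<le> ln (card T) / c) \<and> (\<forall>\<sigma>\<in>P. good \<sigma>)"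
  using assms(1) select
proof (induction T rule: finite_psubset_induct)
  case (psubset T)
  show ?case
  proof (cases "T = {}")
    case True
    then show ?thesis by (intro exI[of _ "{}"]) (auto simp: partition_on_def)
  next
    case False
    then obtain \<sigma> where \<sigma>: "\<sigma> \<subseteq> T" "\<sigma> \<noteq> {}" "c * card T \<le> card \<sigma>" "good \<sigma>"
      using psubset.prems by blast
    let ?T' = "T - \<sigma>"
    have "?T' \<subset> T" using \<sigma> by blast
    moreover have "\<exists>\<sigma>\<subseteq>\<tau>. \<sigma> \<noteq> {} \<and> c * card \<tau> \<le> card \<sigma> \<and> good \<sigma>" if "\<tau> \<subseteq> ?T'" "\<tau> \<noteq> {}" for \<tau>
      using that by (intro psubset.prems) auto
    ultimately obtain P where P: "partition_on ?T' P" "card P \<le> card ?T'"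
      "2 \<le> card ?T' \<Longrightarrow> real (card P) \<le> ln (card ?T') / c" "\<forall>\<sigma>\<in>P. good \<sigma>"
      using psubset.IH[of ?T'] by auto
    have part: "partition_on T (insert \<sigma> P)"
      using P(1) \<sigma>(1,2) unfolding partition_on_def disjoint_def by auto
    have finP: "finite P"
      using P(1) psubset.hyps by (metis finite_Diff finite_elements)
    then have cardP: "card (insert \<sigma> P) \<le> Suc (card P)" by (simp add: card_insert_if)
    have fin\<sigma>: "finite \<sigma>" using \<sigma>(1) psubset.hyps finite_subset by blast
    have card\<sigma>: "0 < card \<sigma>" "card \<sigma> \<le> card T"
      using \<sigma> fin\<sigma> psubset.hyps by (auto simp: card_gt_0_iff card_mono)
    have cardT': "card ?T' = card T - card \<sigma>" using \<sigma>(1) fin\<sigma> by (simp add: card_Diff_subset)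
    have le: "card (insert \<sigma> P) \<le> card T" using cardP P(2) cardT' card\<sigma> by linarith
    have "real (card (insert \<sigma> P)) \<le> ln (card T) / c" if two: "2 \<le> card T"
    proof -
      let ?k = "real (card T)"
      have "ln 2 \<le> ln ?k" using two by simp
      then have half: "1 / 2 \<le> ln ?k" using half_le_ln_2 by linarith
      consider "card T = 2" | "3 \<le> card T" "c * ?k \<le> 1" | "card ?T' \<le> 1"
        | "2 \<le> card ?T'" "1 < c * ?k" using two by linarith
      then show ?thesis
      proof cases
        case 1
        have "real (card (insert \<sigma> P)) * c \<le> 2 * (1 / 9)"
          using le 1 c by (intro mult_mono) auto
        then show ?thesis using half c by (simp add: pos_le_divide_eq)
      next
        case 2
        have "exp 1 \<le> ?k" using exp_le 2(1) by linarith
        then have "1 \<le> ln ?k" using two by (simp add: ln_ge_iff)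
        moreover have "real (card (insert \<sigma> P)) * c \<le> ?k * c"
          using le c by (intro mult_right_mono) auto
        ultimately have "real (card (insert \<sigma> P)) * c \<le> ln ?k"
          using 2(2) by (simp add: mult.commute)
        then show ?thesis using c by (simp add: pos_le_divide_eq)
      next
        case 3
        have "real (card (insert \<sigma> P)) * c \<le> 2 * (1 / 9)"
          using cardP P(2) 3 c by (intro mult_mono) auto
        then show ?thesis using half c by (simp add: pos_le_divide_eq)
      next
        case 4
        have "real (card ?T') \<le> ?k * (1 - c)"
          using cardT' card\<sigma>(2) \<sigma>(3) by (simp add: algebra_simps)
        then have "ln (card ?T') \<le> ln (?k * (1 - c))" using 4(1) by simp
        also have "\<dots> = ln ?k + ln (1 - c)" using two c by (simp add: ln_mult)
        also have "\<dots> \<le> ln ?k - c" using ln_le_minus_one[of "1 - c"] c by simp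
        finally have "ln (card ?T') / c \<le> (ln ?k - c) / c" using c by (intro divide_right_mono) auto
        then have "ln (card ?T') / c + 1 \<le> ln ?k / c" using c by (simp add: diff_divide_distrib)
        moreover have "real (card (insert \<sigma> P)) \<le> card P + 1" using cardP by simp
        ultimately show ?thesis using P(3)[OF 4(1)] by linarith
      qed
    qed
    then show ?thesis using part le P(4) \<sigma>(4) by (intro exI[of _ "insert \<sigma> P"]) auto
  qed
qed

section \<open>Singular values and the partition theorem\<close>

lemma col_restrict_mult:
  assumes "x \<in> coord_space \<sigma>"
  shows "col_restrict U \<sigma> *v x = (U::real^'m^'n) *v x"
  using assms
  by (auto simp: vec_eq_iff matrix_vector_mult_def col_restrict_def coord_space_def intro!: sum.cong)

lemma singular_value_bounds:
  fixes U :: "real^'m^'n"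
  assumes "near_isometry_on U \<epsilon> \<sigma>" "\<sigma> \<noteq> {}"
  shows "1 - \<epsilon> \<le> s_min U \<sigma>" "s_min U \<sigma> \<le> s_max U \<sigma>" "s_max U \<sigma> \<le> 1 + \<epsilon>"
proof -
  have bounds: "1 - \<epsilon> \<le> t \<and> t \<le> 1 + \<epsilon>" if "t \<in> unit_values U \<sigma>" for t
    using that assms(1) by (auto simp: unit_values_def near_isometry_on_def col_restrict_mult)
  show "1 - \<epsilon> \<le> s_min U \<sigma>" "s_max U \<sigma> \<le> 1 + \<epsilon>"
    using bounds s_min_attained[OF assms(2)] s_max_attained[OF assms(2)] by blast+
  show "s_min U \<sigma> \<le> s_max U \<sigma>"
    unfolding s_max_def
    by (intro cSup_upper s_min_attained assms(2) bounded_imp_bdd_above compact_imp_bounded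
        compact_unit_values)
qed

theorem corollary4p4:
  fixes U :: "real^'m^'n" and \<epsilon> :: real
  assumes "CARD('m) \<ge> 2"
    and "standardized U"
    and "0 < \<epsilon>" and "\<epsilon> < 1"
  shows "\<exists>P. partition_on (UNIV :: 'm set) P \<and>
    real (card P) \<le> 9 * (onorm ((*v) U))\<^sup>2 * ln (real CARD('m)) / \<epsilon>\<^sup>2 \<and>
    (\<forall>\<sigma>\<in>P. 1 - \<epsilon> \<le> s_min U \<sigma> \<and> s_min U \<sigma> \<le> s_max U \<sigma> \<and> s_max U \<sigma> \<le> 1 + \<epsilon>)"
proof -
  let ?L = "(onorm ((*v) U))\<^sup>2"
  let ?c = "\<epsilon>\<^sup>2 / (9 * ?L)"
  have L: "1 \<le> ?L" using onorm_ge_1_of_standardized[OF assms(2)] by simp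
  then have c: "0 < ?c" using assms(3) by (intro divide_pos_pos) auto
  have "\<epsilon>\<^sup>2 \<le> 1" using assms(3,4) by (simp add: power_le_one)
  then have c9: "?c \<le> 1 / 9" using L by (simp add: divide_le_eq)
  obtain P where P: "partition_on (UNIV :: 'm set) P" "real (card P) \<le> ln CARD('m) / ?c"
    "\<forall>\<sigma>\<in>P. near_isometry_on U \<epsilon> \<sigma>"
    using greedy_partition[OF finite[of "UNIV :: 'm set"] c c9, of "near_isometry_on U \<epsilon>"]
      exists_large_near_isometry[OF assms(2) _ assms(3,4)] assms(1) by auto
  have "\<sigma> \<noteq> {}" if "\<sigma> \<in> P" for \<sigma> using P(1) that by (auto simp: partition_on_def)
  then have "\<forall>\<sigma>\<in>P. 1 - \<epsilon> \<le> s_min U \<sigma> \<and> s_min U \<sigma> \<le> s_max U \<sigma> \<and> s_max U \<sigma> \<le> 1 + \<epsilon>"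
    using singular_value_bounds P(3) by blast
  moreover have "ln (real CARD('m)) / ?c = 9 * ?L * ln (real CARD('m)) / \<epsilon>\<^sup>2" by simp
  ultimately show ?thesis using P(1,2) by (intro exI[of _ P]) (simp only: simp_thms)
qed

end
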